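(* Let $m_1,m_2\ge1$, $0<a<\infty$, $\mathcal{D}=\{(x,t):0\le x<\infty,\ 0\le t<a\}$, and let $v\in C_\varepsilon(\mathcal{D})$ be an $m_1\times m_2$ matrix function satisfying on $\mathcal{D}$ the matrix defocusing nonlinear Schrödinger equation $2v_t=\mathrm{i}(v_{xx}-2vv^*v)$. If the entries of $v(0,t)$ (respectively, of $v_x(0,t)$), $0\le t<a$, are quasi-analytic, then the matrix function $v(0,t)$ (respectively, $v_x(0,t)$) is uniquely determined on $[0,a)$ by the initial condition $v(x,0)=\mathcal{V}(x)$, $x\ge0$. That is, if quasi-analytic classes are fixed for each entry and $v,\tilde v\in C_\varepsilon(\mathcal{D})$ are two solutions with $v(x,0)=\tilde v(x,0)$ for all $x\ge 0$, then $v(0,t)=\tilde v(0,t)$ on $[0,a)$ whenever the entries of both $v(0,t)$ and $\tilde v(0,t)$ belong to the fixed classes, and $v_x(0,t)=\tilde v_x(0,t)$ on $[0,a)$ whenever the entries of both $v_x(0,t)$ and $\tilde v_x(0,t)$ belong to the fixed classes.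
   Context: Matrix functions are complex-valued; $v^*$ is the conjugate transpose. On the boundary of a domain, derivatives are the appropriate one-sided derivatives. "Continuously differentiable" means differentiable with continuous first derivatives. Class $C_\varepsilon(\mathcal{D})$: the set of $m_1\times m_2$ matrix functions $v(x,t)$ on $\mathcal{D}$ which are continuously differentiable on $\mathcal{D}$, for which $v_{xx}$ exists on $\mathcal{D}$, and such that for each integer $k\ge 0$ there is $\varepsilon_k=\varepsilon_k(v)>0$ such that $v$ is $k$ times continuously differentiable with respect to $x$ in the square $\mathcal{D}(\varepsilon_k)=\{(x,t):0\le x\le\varepsilon_k,\ 0\le t\le\varepsilon_k\}\subset\mathcal{D}$. Quasi-analytic classes: for constants $\widetilde M_k>0$ ($k\ge0$), $C(\{\widetilde M_k\})$ is the class of all infinitely differentiable scalar functions $f$ on $[0,a)$ such that for some $c(f)\ge 0$ we have $\left|\frac{d^kf}{dx^k}(x)\right|\le c(f)^{k+1}\widetilde M_k$ for all $x\in[0,a)$ and all $k\ge 0$. This class is called quasi-analytic if for every $f$ in it and any $0\le x<a$ the equalities $\frac{d^kf}{dx^k}(x)=0$ for all $k\ge0$ imply $f\equiv0$. The entries of a matrix function on $[0,a)$ are quasi-analytic if, for each $(i,j)$, the $(i,j)$ entry belongs to some quasi-analytic class $C(\{\widetilde M_k(i,j)\}_{k\ge 0})$. *)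

theory Defs
  imports "HOL-Analysis.Analysis"
begin

text \<open>Functions are total; only their values on the set \<open>S\<close> (or on the domain below) matter.
  Derivatives are taken within that set and are therefore one-sided at its boundary points.
  All derivatives below are derivatives in a real variable.\<close>

primrec iter_deriv_within ::
    "real set \<Rightarrow> nat \<Rightarrow> (real \<Rightarrow> 'b::real_normed_vector) \<Rightarrow> real \<Rightarrow> 'b" where
  "iter_deriv_within S 0 f = f"
| "iter_deriv_within S (Suc k) f =
     (\<lambda>x. vector_derivative (iter_deriv_within S k f) (at x within S))"

definition times_differentiable_on ::
    "nat \<Rightarrow> real set \<Rightarrow> (real \<Rightarrow> 'b::real_normed_vector) \<Rightarrow> bool" where
  "times_differentiable_on k S f \<longleftrightarrow> (\<forall>j<k. iter_deriv_within S j f differentiable_on S)"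

definition infinitely_differentiable_on ::
    "real set \<Rightarrow> (real \<Rightarrow> 'b::real_normed_vector) \<Rightarrow> bool" where
  "infinitely_differentiable_on S f \<longleftrightarrow> (\<forall>k. times_differentiable_on k S f)"

definition nls_domain :: "real \<Rightarrow> (real \<times> real) set" where
  "nls_domain a = {(x, t). 0 \<le> x \<and> 0 \<le> t \<and> t < a}"

definition corner_square :: "real \<Rightarrow> (real \<times> real) set" where
  "corner_square e = {(x, t). 0 \<le> x \<and> x \<le> e \<and> 0 \<le> t \<and> t \<le> e}"

definition deriv_x :: "(real \<Rightarrow> real \<Rightarrow> 'b::real_normed_vector) \<Rightarrow> real \<Rightarrow> real \<Rightarrow> 'b" where
  "deriv_x v x t = vector_derivative (\<lambda>y. v y t) (at x within {0..})"

definition deriv_t ::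
    "real \<Rightarrow> (real \<Rightarrow> real \<Rightarrow> 'b::real_normed_vector) \<Rightarrow> real \<Rightarrow> real \<Rightarrow> 'b" where
  "deriv_t a v x t = vector_derivative (\<lambda>s. v x s) (at t within {0..<a})"

definition continuously_differentiable ::
    "real \<Rightarrow> (real \<Rightarrow> real \<Rightarrow> 'b::real_normed_vector) \<Rightarrow> bool" where
  "continuously_differentiable a v \<longleftrightarrow>
     (\<lambda>(x, t). v x t) differentiable_on nls_domain a \<and>
     continuous_on (nls_domain a) (\<lambda>(x, t). deriv_x v x t) \<and>
     continuous_on (nls_domain a) (\<lambda>(x, t). deriv_t a v x t)"

text \<open>Continuity of the \<open>x\<close>-derivatives is joint continuity in \<open>(x, t)\<close> on the square.\<close>

definition times_continuously_differentiable_x ::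
    "nat \<Rightarrow> real \<Rightarrow> (real \<Rightarrow> real \<Rightarrow> 'b::real_normed_vector) \<Rightarrow> bool" where
  "times_continuously_differentiable_x k e v \<longleftrightarrow>
     (\<forall>t\<in>{0..e}. times_differentiable_on k {0..e} (\<lambda>x. v x t)) \<and>
     (\<forall>j\<le>k. continuous_on (corner_square e)
        (\<lambda>(x, t). iter_deriv_within {0..e} j (\<lambda>y. v y t) x))"

text \<open>An \<open>m\<^sub>1 \<times> m\<^sub>2\<close> matrix has type \<open>complex ^ 'm2 ^ 'm1\<close>; the index types are finite and nonempty.\<close>

definition C_eps :: "real \<Rightarrow> (real \<Rightarrow> real \<Rightarrow> complex ^ 'm2 ^ 'm1) set" where
  "C_eps a = {v. continuously_differentiable a v \<and>
     (\<forall>(x, t)\<in>nls_domain a. (\<lambda>y. deriv_x v y t) differentiable (at x within {0..})) \<and>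
     (\<forall>k. \<exists>e>0. corner_square e \<subseteq> nls_domain a \<and> times_continuously_differentiable_x k e v)}"

definition conj_transpose :: "complex ^ 'n ^ 'm \<Rightarrow> complex ^ 'm ^ 'n" where
  "conj_transpose A = (\<chi> i j. cnj (A $ j $ i))"

definition cscale :: "complex \<Rightarrow> complex ^ 'n ^ 'm \<Rightarrow> complex ^ 'n ^ 'm" where
  "cscale c A = (\<chi> i j. c * A $ i $ j)"

definition solves_defocusing_nls :: "real \<Rightarrow> (real \<Rightarrow> real \<Rightarrow> complex ^ 'm2 ^ 'm1) \<Rightarrow> bool" where
  "solves_defocusing_nls a v \<longleftrightarrow>
     (\<forall>(x, t)\<in>nls_domain a.
        cscale 2 (deriv_t a v x t) =
        cscale \<i> (deriv_x (deriv_x v) x t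
                 - cscale 2 (v x t ** conj_transpose (v x t) ** v x t)))"

text \<open>The class attached to a sequence of constants on \<open>[0,a)\<close>; the constants are required to be
  positive in \<open>quasi_analytic\<close>.\<close>

definition C_class :: "real \<Rightarrow> (nat \<Rightarrow> real) \<Rightarrow> (real \<Rightarrow> complex) set" where
  "C_class a M = {f. infinitely_differentiable_on {0..<a} f \<and>
     (\<exists>c\<ge>0. \<forall>x\<in>{0..<a}. \<forall>k. cmod (iter_deriv_within {0..<a} k f x) \<le> c ^ (k + 1) * M k)}"

definition quasi_analytic :: "real \<Rightarrow> (nat \<Rightarrow> real) \<Rightarrow> bool" where
  "quasi_analytic a M \<longleftrightarrow> (\<forall>k. M k > 0) \<and>
     (\<forall>f\<in>C_class a M. \<forall>x\<in>{0..<a}.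
        (\<forall>k. iter_deriv_within {0..<a} k f x = 0) \<longrightarrow> (\<forall>y\<in>{0..<a}. f y = 0))"

definition entries_in_classes ::
    "real \<Rightarrow> ('m1 \<Rightarrow> 'm2 \<Rightarrow> nat \<Rightarrow> real) \<Rightarrow> (real \<Rightarrow> complex ^ 'm2 ^ 'm1) \<Rightarrow> bool" where
  "entries_in_classes a M F \<longleftrightarrow> (\<forall>i j. (\<lambda>t. F t $ i $ j) \<in> C_class a (M i j))"

end

(*  The difference u = v - w vanishes at t = 0 and satisfies |u_t| <= K (|u_xx| + |u|) near the corner
    (0,0).  The Landau-Kolmogorov inequality bounds u_x and u_xx by u and a high x-derivative of u,
    which is bounded near the corner.  Inserting the bound for u_xx into the equation and integrating
    in time improves the order of vanishing of u at t = 0, so that u and u_x vanish there to infinite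
    order.  All t-derivatives of u(0,t) and u_x(0,t) at t = 0 are therefore zero, whenever they exist,
    and quasi-analyticity gives the claim. *)
theory Submission
  imports Defs
begin

text \<open>The obstacle is that the squares of smoothness may shrink as the number of x-derivatives
  grows, so no neighbourhood of the corner need carry all of them. Each order of vanishing is
  therefore reached with finitely many derivatives, on a square depending on that order;
  infinite-order vanishing tolerates this because its constants and neighbourhoods may depend on the
  order. The equation is used only pointwise and is never differentiated, since \<open>C_eps\<close>
  promises no mixed or higher t-derivatives. The corner lies on the boundary in both variables, so
  the interpolation inequalities must hold up to the endpoints of an interval. They are kept with an
  explicit interval length: a short interval damps the highest derivative and amplifies the
  function, and the length is tuned to the size of the function. The same device, applied in t,
  passes flatness from the boundary values to their t-derivatives.\<close>

section \<open>Interpolation inequalities on a compact interval\<close>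

lemma vector_deriv_bound:
  fixes f :: "real \<Rightarrow> 'a::real_normed_vector"
  assumes "convex S"
    and "\<And>x. x \<in> S \<Longrightarrow> (f has_vector_derivative f' x) (at x within S)"
    and "\<And>x. x \<in> S \<Longrightarrow> norm (f' x) \<le> B"
    and "x \<in> S" "y \<in> S"
  shows "norm (f x - f y) \<le> B * norm (x - y)"
  using assms
  by (intro differentiable_bound[of S f "\<lambda>x h. h *\<^sub>R f' x"])
    (auto simp: has_vector_derivative_def mult.commute[of B] intro!: onorm_le mult_left_mono)

text \<open>A window centred at \<open>x\<close> could leave \<open>{c..d}\<close>. It is started at
  \<open>x\<close> instead and pushed left only as far as needed to end at \<open>d\<close>.\<close>

lemma subinterval_containing:
  fixes x :: real
  assumes "x \<in> {c..d}" "0 < l" "l \<le> d - c"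
  obtains p where "x \<in> {p..p + l}" "{p..p + l} \<subseteq> {c..d}"
  using assms by (intro that[of "min x (d - l)"]) auto

text \<open>The derivative varies by at most B (d - c), so the increment \<open>f d - f c\<close>
  equals (d - c) f'(x) up to B (d - c)^2. This comparison needs no intermediate point and so works
  for vector values and for \<open>x\<close> at an endpoint.\<close>

lemma deriv_bound_of_second_deriv:
  fixes f f' f'' :: "real \<Rightarrow> 'a::real_normed_vector"
  assumes cd: "c < d"
    and f': "\<And>x. x \<in> {c..d} \<Longrightarrow> (f has_vector_derivative f' x) (at x within {c..d})"
    and f'': "\<And>x. x \<in> {c..d} \<Longrightarrow> (f' has_vector_derivative f'' x) (at x within {c..d})"
    and A: "\<And>x. x \<in> {c..d} \<Longrightarrow> norm (f x) \<le> A"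
    and B: "\<And>x. x \<in> {c..d} \<Longrightarrow> norm (f'' x) \<le> B"
    and x: "x \<in> {c..d}"
  shows "norm (f' x) \<le> 2 * A / (d - c) + B * (d - c)"
proof -
  let ?L = "d - c"
  have B0: "0 \<le> B" using B[OF x] norm_ge_zero order_trans by blast
  have 1: "norm (f' y - f' x) \<le> B * ?L" if y: "y \<in> {c..d}" for y
  proof -
    have "norm (f' y - f' x) \<le> B * norm (y - x)"
      using f'' B y x
      by (intro vector_deriv_bound[of "{c..d}"]) auto
    also have "\<dots> \<le> B * ?L" using B0 x y by (intro mult_left_mono) auto
    finally show ?thesis .
  qed
  have 2: "norm ((f d - f c) - ?L *\<^sub>R f' x) \<le> B * ?L * ?L"
    using vector_differentiable_bound_linearization[OF f', of c d x "B * ?L"] 1 cd x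
    by (simp add: closed_segment_eq_real_ivl mult_ac)
  have "?L * norm (f' x) = norm (?L *\<^sub>R f' x)" using cd by simp
  also have "\<dots> \<le> norm (f d - f c) + B * ?L * ?L"
    using 2 norm_triangle_ineq3[of "f d - f c" "?L *\<^sub>R f' x"] by linarith
  also have "\<dots> \<le> 2 * A + B * ?L * ?L"
    using A[of d] A[of c] cd norm_triangle_ineq4[of "f d" "f c"] by auto
  finally show ?thesis using cd by (simp add: field_simps)
qed

text \<open>Induction on the order: the claim for the derivative sequence bounds \<open>F 2\<close>
  by the maximum of the norm of \<open>F 1\<close> and the top derivative; the second-order
  inequality on a short window then bounds that maximum by half of itself plus the wanted terms, and
  the half is absorbed.\<close>

lemma landau_kolmogorov_first:
  fixes F :: "nat \<Rightarrow> real \<Rightarrow> 'a::real_normed_vector"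
  assumes "c < d"
    and "\<And>j x. j < n + 2 \<Longrightarrow> x \<in> {c..d} \<Longrightarrow>
           (F j has_vector_derivative F (Suc j) x) (at x within {c..d})"
    and "\<And>x. x \<in> {c..d} \<Longrightarrow> norm (F 0 x) \<le> A"
    and "\<And>x. x \<in> {c..d} \<Longrightarrow> norm (F (n + 2) x) \<le> B"
    and "x \<in> {c..d}"
  shows "norm (F 1 x) \<le> 2 * 8 ^ n * (A / (d - c) + B * (d - c) ^ (n + 1))"
  using assms
proof (induction n arbitrary: F A x)
  case 0
  have "norm (F 1 x) \<le> 2 * A / (d - c) + B * (d - c)"
    by (rule deriv_bound_of_second_deriv[where f = "F 0" and f'' = "F 2"])
      (use 0 in \<open>auto simp: numeral_2_eq_2\<close>)
  moreover have "0 \<le> B" using 0(4)[OF 0(5)] norm_ge_zero order_trans by blast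
  then have "0 \<le> B * (d - c)" using \<open>c < d\<close> by simp
  ultimately show ?case by simp
next
  case (Suc n)
  define L where "L = d - c"
  define C :: real where "C = 2 * 8 ^ n"
  have C: "2 \<le> C" by (simp add: C_def)
  have L: "0 < L" using Suc.prems by (simp add: L_def)
  have A0: "0 \<le> A" using Suc.prems(3)[OF Suc.prems(5)] norm_ge_zero order_trans by blast
  have B0: "0 \<le> B" using Suc.prems(4)[OF Suc.prems(5)] norm_ge_zero order_trans by blast
  \<comment> \<open>Absorption needs a finite bound for \<open>F 1\<close>. The attained maximum is
    taken, and the second-order inequality is applied at the point where it is attained.\<close>
  have "continuous_on {c..d} (F 1)"
    using has_vector_derivative_continuous[OF Suc.prems(2)[of 1]]
    by (auto simp: continuous_on_eq_continuous_within)
  then have "continuous_on {c..d} (\<lambda>x. norm (F 1 x))" by (intro continuous_intros)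
  from continuous_attains_sup[OF compact_Icc _ this] \<open>c < d\<close>
  obtain x0 where x0: "x0 \<in> {c..d}" and mx: "\<And>y. y \<in> {c..d} \<Longrightarrow> norm (F 1 y) \<le> norm (F 1 x0)"
    by auto
  define S where "S = norm (F 1 x0)"
  have F2: "norm (F 2 y) \<le> C * (S / L + B * L ^ (n + 1))" if "y \<in> {c..d}" for y
    using Suc.IH[of "\<lambda>j. F (Suc j)" S y] Suc.prems that mx
    by (auto simp: S_def C_def L_def numeral_2_eq_2)
  \<comment> \<open>With this length C l = L / 2, so the coefficient of \<open>S\<close> becomes
    1/2. The term 2 A / l is 4 C A / L and doubles when S / 2 is absorbed, whence the factor 8 per
    step.\<close>
  define l where "l = L / (2 * C)"
  have l: "0 < l" "l \<le> d - c" using C L by (auto simp: l_def L_def[symmetric] field_simps)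
  obtain p where p: "x0 \<in> {p..p + l}" "{p..p + l} \<subseteq> {c..d}"
    using subinterval_containing[OF x0 l] .
  have "norm (F 1 x0) \<le> 2 * A / (p + l - p) + (C * (S / L + B * L ^ (n + 1))) * (p + l - p)"
  proof (rule deriv_bound_of_second_deriv[where f = "F 0" and f'' = "F 2"])
    fix y assume y: "y \<in> {p..p + l}"
    then have y': "y \<in> {c..d}" using p by blast
    show "(F 0 has_vector_derivative F 1 y) (at y within {p..p + l})"
      using has_vector_derivative_within_subset[OF Suc.prems(2)[of 0 y] p(2)] y' by simp
    show "(F 1 has_vector_derivative F 2 y) (at y within {p..p + l})"
      using has_vector_derivative_within_subset[OF Suc.prems(2)[of 1 y] p(2)] y'
      by (simp add: numeral_2_eq_2)
    show "norm (F 0 y) \<le> A" "norm (F 2 y) \<le> C * (S / L + B * L ^ (n + 1))"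
      using Suc.prems(3) F2 y' by blast+
  qed (use l p in auto)
  then have "S \<le> 2 * A / l + C * (S / L + B * L ^ (n + 1)) * l" by (simp add: S_def)
  also have "2 * A / l = 4 * C * A / L" using C L by (simp add: l_def)
  also have "C * (S / L + B * L ^ (n + 1)) * l = S / 2 + B * L ^ (n + 2) / 2"
  proof -
    have "C * l = L / 2" using C by (simp add: l_def)
    then have "C * (S / L + B * L ^ (n + 1)) * l = (S / L + B * L ^ (n + 1)) * (L / 2)"
      by (metis mult.assoc mult.commute)
    also have "\<dots> = S / 2 + B * (L ^ (n + 1) * L) / 2"
      using L by (simp only: distrib_right) simp
    also have "L ^ (n + 1) * L = L ^ (n + 2)" by simp
    finally show ?thesis .
  qed
  finally have "S \<le> 8 * C * (A / L) + B * L ^ (n + 2)" by simp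
  also have "\<dots> \<le> 8 * C * (A / L) + 8 * C * (B * L ^ (n + 2))"
    using mult_right_mono[of 1 "8 * C" "B * L ^ (n + 2)"] C B0 L by simp
  finally show ?case using mx[OF Suc.prems(5)]
    by (simp add: S_def C_def L_def distrib_left mult_ac)
qed

text \<open>The first-derivative estimate is used twice, for \<open>F\<close> and then for its
  derivative sequence, with the first bound \<open>S\<close> as the new \<open>A\<close>. The
  factors multiply to 32 * 64^n, and the left-over 2 * 8^n is covered by rounding up to 64 *
  64^n.\<close>

lemma landau_kolmogorov_second:
  fixes F :: "nat \<Rightarrow> real \<Rightarrow> 'a::real_normed_vector"
  assumes cd: "c < d"
    and F: "\<And>j x. j < n + 3 \<Longrightarrow> x \<in> {c..d} \<Longrightarrow>
           (F j has_vector_derivative F (Suc j) x) (at x within {c..d})"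
    and A: "\<And>x. x \<in> {c..d} \<Longrightarrow> norm (F 0 x) \<le> A"
    and B: "\<And>x. x \<in> {c..d} \<Longrightarrow> norm (F (n + 3) x) \<le> B"
    and x: "x \<in> {c..d}"
  shows "norm (F 2 x) \<le> 64 * 64 ^ n * (A / (d - c)\<^sup>2 + B * (d - c) ^ (n + 1))"
proof -
  define L where "L = d - c"
  have L: "0 < L" using cd by (simp add: L_def)
  have B0: "0 \<le> B" using B[OF x] norm_ge_zero order_trans by blast
  define S where "S = 16 * 8 ^ n * (A / L + B * L ^ (n + 2))"
  have "norm (F 1 y) \<le> S" if "y \<in> {c..d}" for y
    using landau_kolmogorov_first[of c d "Suc n" F A B y] cd F A B that
    by (auto simp: S_def L_def numeral_3_eq_3)
  then have "norm (F 2 x) \<le> 2 * 8 ^ n * (S / L + B * L ^ (n + 1))"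
    using landau_kolmogorov_first[of c d n "\<lambda>j. F (Suc j)" S B x] cd F B x
    by (auto simp: L_def numeral_3_eq_3 numeral_2_eq_2)
  also have "S / L = 16 * 8 ^ n * (A / L\<^sup>2 + B * L ^ (n + 1))"
  proof -
    have "L ^ (n + 2) / L = L ^ (n + 1)" using L by simp
    then have "(A / L + B * L ^ (n + 2)) / L = A / L\<^sup>2 + B * L ^ (n + 1)"
      by (simp only: add_divide_distrib times_divide_eq_right[symmetric] power2_eq_square divide_divide_eq_left)
    then show ?thesis by (simp only: S_def times_divide_eq_right[symmetric])
  qed
  also have "2 * 8 ^ n * (16 * 8 ^ n * (A / L\<^sup>2 + B * L ^ (n + 1)) + B * L ^ (n + 1))
     = 32 * 64 ^ n * (A / L\<^sup>2) + (32 * 64 ^ n + 2 * 8 ^ n) * (B * L ^ (n + 1))"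
  proof -
    have "(8::real) ^ n * 8 ^ n = 64 ^ n" by (simp flip: power_mult_distrib)
    moreover have "2 * e * (16 * e * (X + Y) + Y) = 32 * q * X + (32 * q + 2 * e) * Y"
      if "e * e = q" for e q X Y :: real
      unfolding that[symmetric] by (simp add: algebra_simps)
    ultimately show ?thesis by blast
  qed
  also have "\<dots> \<le> 64 * 64 ^ n * (A / L\<^sup>2) + 64 * 64 ^ n * (B * L ^ (n + 1))"
  proof (intro add_mono mult_right_mono)
    have "(8::real) ^ n \<le> 64 ^ n" by (intro power_mono) auto
    then show "(32 * 64 ^ n + 2 * 8 ^ n :: real) \<le> 64 * 64 ^ n" using zero_le_power[of "64::real" n] by linarith
    have "0 \<le> A" using A[OF x] norm_ge_zero order_trans by blast
    then show "0 \<le> A / L\<^sup>2" by simp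
  qed (use B0 L in auto)
  finally show ?thesis by (simp only: L_def distrib_left)
qed

section \<open>Vanishing to infinite order at 0\<close>

text \<open>Expressed by growth and not by derivatives, because it has to be established for
  boundary values whose higher t-derivatives are not known to exist.\<close>

definition flat_at_0 :: "(real \<Rightarrow> 'a::real_normed_vector) \<Rightarrow> bool" where
  "flat_at_0 f \<longleftrightarrow> (\<forall>n. \<exists>e>0. \<exists>C. \<forall>t\<in>{0..e}. norm (f t) \<le> C * t ^ n)"

lemma flat_at_0_zero: "flat_at_0 f \<Longrightarrow> f 0 = 0"
  unfolding flat_at_0_def by (drule spec[of _ 1]) force

lemma flat_at_0_mono:
  assumes f: "flat_at_0 f" and le: "\<And>t. norm (g t) \<le> norm (f t)"
  shows "flat_at_0 g"
  unfolding flat_at_0_def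
proof
  fix n
  from f obtain e C where "0 < e" "\<forall>t\<in>{0..e}. norm (f t) \<le> C * t ^ n"
    unfolding flat_at_0_def by blast
  then show "\<exists>e>0. \<exists>C. \<forall>t\<in>{0..e}. norm (g t) \<le> C * t ^ n"
    using order_trans[OF le] by blast
qed

text \<open>Interpolation between f = O(t^(2(n+1))) and a bounded second derivative on a window of
  length t^(n+1) makes both terms of order t^(n+1). The window lies inside \<open>{0..t}\<close>,
  where the bound for \<open>f\<close> is largest at the right end.\<close>

lemma flat_at_0_deriv:
  fixes f :: "real \<Rightarrow> 'a::real_normed_vector"
  assumes flat: "flat_at_0 f" and b: "0 < b"
    and f': "\<And>t. t \<in> {0..b} \<Longrightarrow> (f has_vector_derivative f' t) (at t within {0..b})"
    and f'': "\<And>t. t \<in> {0..b} \<Longrightarrow> (f' has_vector_derivative f'' t) (at t within {0..b})"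
    and bdd: "\<And>t. t \<in> {0..b} \<Longrightarrow> norm (f'' t) \<le> B"
  shows "flat_at_0 f'"
  unfolding flat_at_0_def
proof
  fix n
  \<comment> \<open>Twice the target order, since the interpolation halves it. Using n + 1 in place
    of n keeps the window length at most t for t <= 1 and forces the limit 0 at t = 0 even when n =
    0.\<close>
  from flat obtain e C where e: "0 < e" and C: "\<And>t. t \<in> {0..e} \<Longrightarrow> norm (f t) \<le> C * t ^ (2 * (n + 1))"
    unfolding flat_at_0_def by meson
  have B0: "0 \<le> B" using order_trans[OF norm_ge_zero bdd[of 0]] b by simp
  have "0 \<le> C * e ^ (2 * (n + 1))"
    by (rule order_trans[OF norm_ge_zero C]) (use e in simp)
  then have C0: "0 \<le> C"
    using zero_less_power[OF e, of "2 * (n + 1)"] by (metis zero_le_mult_iff not_le)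
  define r where "r = min (min e b) 1"
  have r: "0 < r" "r \<le> e" "r \<le> b" "r \<le> 1" using e b by (auto simp: r_def)
  have pos: "norm (f' t) \<le> (2 * C + B) * t ^ (n + 1)" if t: "0 < t" "t \<le> r" for t
  proof -
    define l where "l = t ^ (n + 1)"
    have l: "0 < l" "l \<le> t - 0"
      using t r power_decreasing[of 1 "n + 1" t] by (auto simp: l_def)
    have "t \<in> {0..t}" using t by simp
    then obtain p where p: "t \<in> {p..p + l}" "{p..p + l} \<subseteq> {0..t}"
      by (rule subinterval_containing[OF _ l])
    have "{0..t} \<subseteq> {0..b}" using t r by simp
    with p(2) have sub: "{p..p + l} \<subseteq> {0..b}" by (rule subset_trans)
    have "norm (f' t) \<le> 2 * (C * l\<^sup>2) / (p + l - p) + B * (p + l - p)"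
    proof (rule deriv_bound_of_second_deriv[where f = f and f'' = f''])
      fix y assume y: "y \<in> {p..p + l}"
      then have y': "y \<in> {0..b}" and y2: "y \<in> {0..t}" using sub p(2) by blast+
      show "(f has_vector_derivative f' y) (at y within {p..p + l})"
        "(f' has_vector_derivative f'' y) (at y within {p..p + l})"
        using f'[OF y'] f''[OF y'] sub by (auto intro: has_vector_derivative_within_subset)
      have "norm (f y) \<le> C * y ^ (2 * (n + 1))" using C y2 t r by simp
      also have "\<dots> \<le> C * t ^ (2 * (n + 1))" using y2 C0 by (intro mult_left_mono power_mono) auto
      also have "t ^ (2 * (n + 1)) = l\<^sup>2" by (simp only: l_def power_mult[symmetric] mult.commute)
      finally show "norm (f y) \<le> C * l\<^sup>2" .
      show "norm (f'' y) \<le> B" using bdd y' .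
    qed (use l p in auto)
    also have "\<dots> = (2 * C + B) * l" using l by (simp add: power2_eq_square distrib_right)
    finally show ?thesis by (simp add: l_def)
  qed
  have cont: "continuous_on {0..b} f'"
    using has_vector_derivative_continuous[OF f''] by (auto simp: continuous_on_eq_continuous_within)
  \<comment> \<open>At t = 0 the window degenerates, so the value there is recovered by continuity
    of \<open>f'\<close>.\<close>
  have z: "norm (f' 0) \<le> 0"
  proof (rule tendsto_upperbound)
    have "(f' \<longlongrightarrow> f' 0) (at 0 within {0..b})"
      using cont b by (auto simp: continuous_on_def)
    then show "((\<lambda>t. norm (f' t) - (2 * C + B) * t ^ (n + 1)) \<longlongrightarrow> norm (f' 0)) (at_right 0)"
      using b by (auto intro!: tendsto_eq_intros simp: at_within_Icc_at_right)
    show "\<forall>\<^sub>F t in at_right 0. norm (f' t) - (2 * C + B) * t ^ (n + 1) \<le> 0"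
      unfolding eventually_at_right_field
    proof (intro exI conjI allI impI)
      show "0 < r" by fact
      fix t assume "0 < t" "t < r"
      then show "norm (f' t) - (2 * C + B) * t ^ (n + 1) \<le> 0" using pos[of t] by linarith
    qed
  qed simp
  have "norm (f' t) \<le> (2 * C + B) * t ^ n" if t: "t \<in> {0..r}" for t
  proof (cases "t = 0")
    case True
    have "0 \<le> (2 * C + B) * t ^ n" using C0 B0 t by simp
    then show ?thesis using True z by simp
  next
    case False
    have "norm (f' t) \<le> (2 * C + B) * t ^ (n + 1)" using pos t False by simp
    also have "\<dots> \<le> (2 * C + B) * t ^ n"
      using t r C0 B0 by (intro mult_left_mono power_decreasing) auto
    finally show ?thesis .
  qed
  then show "\<exists>e>0. \<exists>C. \<forall>t\<in>{0..e}. norm (f' t) \<le> C * t ^ n"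
    using r by blast
qed

section \<open>Iterated derivatives of flat functions; quasi-analytic classes\<close>

lemma iter_deriv_within_has_vector_derivative:
  assumes "infinitely_differentiable_on S f" "x \<in> S"
  shows "(iter_deriv_within S k f has_vector_derivative iter_deriv_within S (Suc k) f x) (at x within S)"
  using assms
  by (auto simp: infinitely_differentiable_on_def times_differentiable_on_def differentiable_on_def
      vector_derivative_works[symmetric])

text \<open>Each derivative inherits flatness from the previous one because the following one is
  bounded near 0. The bound comes from compactness of \<open>{0..a/2}\<close>; towards
  \<open>a\<close> the derivatives may blow up.\<close>

lemma flat_at_0_iter_deriv_eq_0:
  fixes f :: "real \<Rightarrow> 'a::real_normed_vector"
  assumes flat: "flat_at_0 f" and a: "0 < a" and f: "infinitely_differentiable_on {0..<a} f"
  shows "iter_deriv_within {0..<a} k f 0 = 0"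
proof -
  let ?D = "\<lambda>k. iter_deriv_within {0..<a} k f"
  note d = iter_deriv_within_has_vector_derivative[OF f]
  have sub: "{0..a/2} \<subseteq> {0..<a}" using a by auto
  have "flat_at_0 (?D k)"
  proof (induction k)
    case (Suc k)
    have "continuous_on {0..<a} (?D (Suc (Suc k)))"
      unfolding continuous_on_eq_continuous_within
      by (intro ballI has_vector_derivative_continuous[OF d])
    then have "compact (?D (Suc (Suc k)) ` {0..a/2})"
      by (intro compact_continuous_image compact_Icc continuous_on_subset[OF _ sub])
    then have "bounded (?D (Suc (Suc k)) ` {0..a/2})" by (rule compact_imp_bounded)
    then obtain B where B: "\<And>t. t \<in> {0..a/2} \<Longrightarrow> norm (?D (Suc (Suc k)) t) \<le> B"
      unfolding bounded_iff by blast
    show ?case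
      by (rule flat_at_0_deriv[OF Suc.IH, of "a/2" _ "?D (Suc (Suc k))" B])
        (use a B sub has_vector_derivative_within_subset[OF d sub] in \<open>auto simp del: iter_deriv_within.simps\<close>)
  qed (simp add: flat)
  then show ?thesis by (rule flat_at_0_zero)
qed

text \<open>\<open>vector_derivative\<close> is a choice operator, so its value is known only once a
  derivative is exhibited and unique. The two claims therefore feed each other: the formula at order
  k yields the derivative, which yields the formula at order k + 1.\<close>

lemma iter_deriv_within_diff:
  fixes f g :: "real \<Rightarrow> 'a::real_normed_vector"
  assumes f: "infinitely_differentiable_on {0..<a} f" and g: "infinitely_differentiable_on {0..<a} g"
    and x: "x \<in> {0..<a}"
  shows "iter_deriv_within {0..<a} k (\<lambda>x. f x - g x) x =
         iter_deriv_within {0..<a} k f x - iter_deriv_within {0..<a} k g x"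
    and "(iter_deriv_within {0..<a} k (\<lambda>x. f x - g x) has_vector_derivative
         iter_deriv_within {0..<a} (Suc k) f x - iter_deriv_within {0..<a} (Suc k) g x) (at x within {0..<a})"
proof -
  let ?D = "iter_deriv_within {0..<a}"
  have step: "(?D k (\<lambda>x. f x - g x) has_vector_derivative ?D (Suc k) f x - ?D (Suc k) g x) (at x within {0..<a})"
    if "\<And>y. y \<in> {0..<a} \<Longrightarrow> ?D k (\<lambda>x. f x - g x) y = ?D k f y - ?D k g y" "x \<in> {0..<a}" for k x
    using has_vector_derivative_transform[OF that(2) that(1)
        has_vector_derivative_diff[OF iter_deriv_within_has_vector_derivative[OF f that(2)]
          iter_deriv_within_has_vector_derivative[OF g that(2)]]]
    by simp
  have eq: "?D k (\<lambda>x. f x - g x) x = ?D k f x - ?D k g x" if "x \<in> {0..<a}" for x k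
    using that
  proof (induction k arbitrary: x)
    case (Suc k)
    have "at x within {0..<a} \<noteq> bot"
      using Suc.prems by (simp add: trivial_limit_within islimpt_Ico)
    then show ?case
      using vector_derivative_within[OF _ step[OF Suc.IH Suc.prems]] by simp
  qed simp
  show "?D k (\<lambda>x. f x - g x) x = ?D k f x - ?D k g x" using eq x .
  show "(?D k (\<lambda>x. f x - g x) has_vector_derivative ?D (Suc k) f x - ?D (Suc k) g x) (at x within {0..<a})"
    using step[OF eq x] .
qed

text \<open>The constants add, since c^(k+1) + d^(k+1) <= (c+d)^(k+1) for nonnegative c and d. The
  exponent k + 1 in the class matters: with exponent 0 this would read 2 <= 1.\<close>

lemma C_class_diff:
  assumes f: "f \<in> C_class a M" and g: "g \<in> C_class a M" and M: "\<And>k. 0 < M k"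
  shows "(\<lambda>x. f x - g x) \<in> C_class a M"
proof -
  let ?D = "iter_deriv_within {0..<a}"
  from f obtain c where c: "0 \<le> c" "\<And>x k. x \<in> {0..<a} \<Longrightarrow> cmod (?D k f x) \<le> c ^ (k + 1) * M k"
    and fi: "infinitely_differentiable_on {0..<a} f"
    unfolding C_class_def by blast
  from g obtain d where d: "0 \<le> d" "\<And>x k. x \<in> {0..<a} \<Longrightarrow> cmod (?D k g x) \<le> d ^ (k + 1) * M k"
    and gi: "infinitely_differentiable_on {0..<a} g"
    unfolding C_class_def by blast
  have "infinitely_differentiable_on {0..<a} (\<lambda>x. f x - g x)"
    unfolding infinitely_differentiable_on_def times_differentiable_on_def differentiable_on_def
    using iter_deriv_within_diff(2)[OF fi gi] differentiableI_vector by blast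
  moreover have "cmod (?D k (\<lambda>x. f x - g x) x) \<le> (c + d) ^ (k + 1) * M k" if x: "x \<in> {0..<a}" for x k
  proof -
    have "cmod (?D k (\<lambda>x. f x - g x) x) \<le> cmod (?D k f x) + cmod (?D k g x)"
      unfolding iter_deriv_within_diff(1)[OF fi gi x] by (rule norm_triangle_ineq4)
    also have "\<dots> \<le> (c ^ (k + 1) + d ^ (k + 1)) * M k"
      using c(2)[OF x, of k] d(2)[OF x, of k] by (simp add: distrib_right)
    also have "\<dots> \<le> (c + d) ^ (k + 1) * M k"
    proof (intro mult_right_mono)
      have "c ^ k \<le> (c + d) ^ k" "d ^ k \<le> (c + d) ^ k" using c d by (auto intro!: power_mono)
      then show "c ^ (k + 1) + d ^ (k + 1) \<le> (c + d) ^ (k + 1)"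
        using c d by (auto simp: distrib_right intro!: add_mono mult_left_mono)
    qed (simp add: M less_imp_le)
    finally show ?thesis .
  qed
  moreover have "0 \<le> c + d" using c d by simp
  ultimately show ?thesis unfolding C_class_def by blast
qed

lemma quasi_analytic_eq:
  fixes F G :: "real \<Rightarrow> complex ^ 'm2 ^ 'm1"
  assumes a: "0 < a" and M: "\<forall>i j. quasi_analytic a (M i j)"
    and F: "entries_in_classes a M F" and G: "entries_in_classes a M G"
    and flat: "flat_at_0 (\<lambda>t. F t - G t)" and t: "t \<in> {0..<a}"
  shows "F t = G t"
proof -
  have "F t $ i $ j = G t $ i $ j" for i j
  proof -
    let ?h = "\<lambda>t. F t $ i $ j - G t $ i $ j"
    have h: "?h \<in> C_class a (M i j)"
      using F G M by (intro C_class_diff) (auto simp: entries_in_classes_def quasi_analytic_def)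
    have "norm (?h t) \<le> norm (F t - G t)" for t
      using order_trans[OF Finite_Cartesian_Product.norm_nth_le[of "(F t - G t) $ i" j]
          Finite_Cartesian_Product.norm_nth_le[of "F t - G t" i]] by simp
    then have "flat_at_0 ?h"
      by (rule flat_at_0_mono[OF flat])
    then have "\<forall>k. iter_deriv_within {0..<a} k ?h 0 = 0"
      using flat_at_0_iter_deriv_eq_0 a h by (auto simp: C_class_def)
    then have "?h t = 0"
      using M h a t unfolding quasi_analytic_def by (meson atLeastLessThan_iff order_refl)
    then show ?thesis by simp
  qed
  then show ?thesis by (simp add: vec_eq_iff)
qed

section \<open>Bounded x-jets near the corner\<close>

text \<open>An explicit family \<open>G\<close> replaces \<open>iter_deriv_within {0..e}\<close>,
  which refers to the particular \<open>e\<close>. Such a family restricts to smaller squares, so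
  jets given on different squares can be subtracted.\<close>

definition x_jet :: "nat \<Rightarrow> real \<Rightarrow> real \<Rightarrow> (nat \<Rightarrow> real \<Rightarrow> real \<Rightarrow> 'a::real_normed_vector) \<Rightarrow> bool" where
  "x_jet k e B G \<longleftrightarrow> (\<forall>t\<in>{0..e}. \<forall>x\<in>{0..e}. norm (G k x t) \<le> B \<and>
     (\<forall>j<k. ((\<lambda>y. G j y t) has_vector_derivative G (Suc j) x t) (at x within {0..e})))"

lemma x_jet_diff:
  assumes "x_jet k e B G" "x_jet k e' B' G'"
  shows "x_jet k (min e e') (B + B') (\<lambda>j x t. G j x t - G' j x t)"
  unfolding x_jet_def
proof (intro ballI conjI allI impI)
  fix t x assume t: "t \<in> {0..min e e'}" and x: "x \<in> {0..min e e'}"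
  then have in1: "t \<in> {0..e}" "x \<in> {0..e}" and in2: "t \<in> {0..e'}" "x \<in> {0..e'}" by auto
  show "norm (G k x t - G' k x t) \<le> B + B'"
    using assms in1 in2 norm_triangle_ineq4[of "G k x t" "G' k x t"]
    unfolding x_jet_def by fastforce
  fix j assume "j < k"
  then have "((\<lambda>y. G j y t) has_vector_derivative G (Suc j) x t) (at x within {0..e})"
    "((\<lambda>y. G' j y t) has_vector_derivative G' (Suc j) x t) (at x within {0..e'})"
    using assms in1 in2 unfolding x_jet_def by blast+
  then show "((\<lambda>y. G j y t - G' j y t) has_vector_derivative G (Suc j) x t - G' (Suc j) x t)
      (at x within {0..min e e'})"
    by (intro has_vector_derivative_diff) (auto elim!: has_vector_derivative_within_subset)
qed

lemma compact_corner_square: "compact (corner_square e)"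
proof -
  have "corner_square e = {0..e} \<times> {0..e}" by (auto simp: corner_square_def)
  then show ?thesis by (simp add: compact_Times)
qed

lemma continuous_on_corner_square_bounded:
  fixes f :: "real \<times> real \<Rightarrow> 'a::real_normed_vector"
  assumes "continuous_on (corner_square e) f"
  obtains B where "\<forall>x\<in>{0..e}. \<forall>t\<in>{0..e}. norm (f (x, t)) \<le> B"
proof -
  have "bounded (f ` corner_square e)"
    by (rule compact_imp_bounded[OF compact_continuous_image[OF assms compact_corner_square]])
  then obtain B where "\<forall>z\<in>corner_square e. norm (f z) \<le> B" unfolding bounded_iff by blast
  then show ?thesis by (intro that[of B]) (auto simp: corner_square_def)
qed

text \<open>\<open>deriv_x\<close> and \<open>deriv_t\<close> are defined by choice; joint
  differentiability, composed with the coordinate lines, shows that they are genuine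
  derivatives.\<close>

lemma C_eps_has_derivs:
  assumes v: "v \<in> C_eps a" and xt: "0 \<le> x" "0 \<le> t" "t < a"
  shows "((\<lambda>y. v y t) has_vector_derivative deriv_x v x t) (at x within {0..})"
    and "((\<lambda>y. deriv_x v y t) has_vector_derivative deriv_x (deriv_x v) x t) (at x within {0..})"
    and "((\<lambda>s. v x s) has_vector_derivative deriv_t a v x t) (at t within {0..<a})"
proof -
  have xt': "(x, t) \<in> nls_domain a" using xt by (simp add: nls_domain_def)
  have "(\<lambda>(x, t). v x t) differentiable_on nls_domain a"
    using v by (simp add: C_eps_def continuously_differentiable_def)
  then have d: "(\<lambda>(x, t). v x t) differentiable at (x, t) within nls_domain a"
    using xt' by (simp add: differentiable_on_def)
  have "(\<lambda>(x, t). v x t) \<circ> (\<lambda>y. (y, t)) differentiable at x within {0..}"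
  proof (rule differentiable_chain_within)
    show "(\<lambda>y. (y, t)) differentiable at x within {0..}"
      by (auto intro!: derivative_intros simp: differentiable_def)
    show "(\<lambda>(x, t). v x t) differentiable at (x, t) within (\<lambda>y. (y, t)) ` {0..}"
      by (rule differentiable_within_subset[OF d]) (use xt in \<open>auto simp: nls_domain_def\<close>)
  qed
  then show "((\<lambda>y. v y t) has_vector_derivative deriv_x v x t) (at x within {0..})"
    by (simp add: o_def deriv_x_def vector_derivative_works)
  have "(\<lambda>(x, t). v x t) \<circ> (\<lambda>s. (x, s)) differentiable at t within {0..<a}"
  proof (rule differentiable_chain_within)
    show "(\<lambda>s. (x, s)) differentiable at t within {0..<a}"
      by (auto intro!: derivative_intros simp: differentiable_def)
    show "(\<lambda>(x, t). v x t) differentiable at (x, t) within (\<lambda>s. (x, s)) ` {0..<a}"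
      by (rule differentiable_within_subset[OF d]) (use xt in \<open>auto simp: nls_domain_def\<close>)
  qed
  then show "((\<lambda>s. v x s) has_vector_derivative deriv_t a v x t) (at t within {0..<a})"
    by (simp add: o_def deriv_t_def vector_derivative_works)
  have "(\<lambda>y. deriv_x v y t) differentiable at x within {0..}"
    using v xt' by (auto simp: C_eps_def)
  then show "((\<lambda>y. deriv_x v y t) has_vector_derivative deriv_x (deriv_x v) x t) (at x within {0..})"
    unfolding deriv_x_def[of "deriv_x v"] by (simp add: vector_derivative_works)
qed

lemma C_eps_x_jet:
  assumes v: "v \<in> C_eps a"
  obtains e B G where "0 < e" "x_jet k e B G"
    "\<And>x t. x \<in> {0..e} \<Longrightarrow> t \<in> {0..e} \<Longrightarrow>
       G 0 x t = v x t \<and> G 1 x t = deriv_x v x t \<and> G 2 x t = deriv_x (deriv_x v) x t"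
proof -
  from v obtain e where e: "0 < e" and sub: "corner_square e \<subseteq> nls_domain a"
    and smooth: "times_continuously_differentiable_x k e v"
    unfolding C_eps_def by blast
  define G where "G j x t = iter_deriv_within {0..e} j (\<lambda>y. v y t) x" for j x t
  have ta: "t < a" if "t \<in> {0..e}" for t
  proof -
    have "(0, t) \<in> corner_square e" using that by (simp add: corner_square_def)
    then show ?thesis using sub by (auto simp: nls_domain_def)
  qed
  have "continuous_on (corner_square e) (\<lambda>(x, t). G k x t)"
    using smooth by (simp add: times_continuously_differentiable_x_def G_def)
  from continuous_on_corner_square_bounded[OF this]
  obtain B where B: "\<forall>x\<in>{0..e}. \<forall>t\<in>{0..e}. norm (G k x t) \<le> B" by auto
  have "((\<lambda>y. G j y t) has_vector_derivative G (Suc j) x t) (at x within {0..e})"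
    if "t \<in> {0..e}" "x \<in> {0..e}" "j < k" for j x t
    using smooth that
    by (simp add: times_continuously_differentiable_x_def times_differentiable_on_def
        differentiable_on_def G_def vector_derivative_works[symmetric])
  with B have jet: "x_jet k e B G" by (auto simp: x_jet_def)
  \<comment> \<open>The jet differentiates within \<open>{0..e}\<close>, \<open>deriv_x\<close>
    within the half-line. The latter restricts to the former, and derivatives within a nondegenerate
    interval are unique, so both agree, also at \<open>e\<close> and whatever \<open>k\<close>
    is.\<close>
  have sub': "{0..e} \<subseteq> {0..}" by auto
  have G1: "G 1 x t = deriv_x v x t" if "x \<in> {0..e}" "t \<in> {0..e}" for x t
    using has_vector_derivative_within_subset[OF C_eps_has_derivs(1)[OF v, of x t] sub'] e that ta
    by (auto simp: G_def intro!: vector_derivative_within_closed_interval)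
  have G2: "G 2 x t = deriv_x (deriv_x v) x t" if x: "x \<in> {0..e}" and t: "t \<in> {0..e}" for x t
  proof -
    have "((\<lambda>y. deriv_x v y t) has_vector_derivative deriv_x (deriv_x v) x t) (at x within {0..e})"
      using has_vector_derivative_within_subset[OF C_eps_has_derivs(2)[OF v, of x t] sub'] x t ta
      by auto
    then have "((\<lambda>y. G 1 y t) has_vector_derivative deriv_x (deriv_x v) x t) (at x within {0..e})"
      by (rule has_vector_derivative_transform[OF x, rotated]) (simp only: G1[OF _ t])
    then have "vector_derivative (\<lambda>y. G 1 y t) (at x within {0..e}) = deriv_x (deriv_x v) x t"
      using e x by (intro vector_derivative_within_closed_interval) auto
    then show ?thesis by (simp add: G_def numeral_2_eq_2)
  qed
  show thesis using that[OF e jet] G1 G2 by (simp add: G_def)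
qed

lemma x_jet_bounds:
  assumes jet: "x_jet (n + 3) e B G" and rho: "0 < \<rho>" "\<rho> \<le> e" "\<rho> \<le> 1"
    and r: "0 < r" "r \<le> \<rho>" and x: "x \<in> {0..\<rho>}"
    and C: "\<And>y. y \<in> {0..\<rho>} \<Longrightarrow> norm (G 0 y (r ^ 4)) \<le> C * r ^ (n + 2)"
  shows "norm (G 1 x (r ^ 4)) \<le> 16 * 8 ^ n * (C / \<rho> + B) * r ^ n"
    and "norm (G 2 x (r ^ 4)) \<le> 64 * 64 ^ n * (C / \<rho>\<^sup>2 + B) * r ^ n"
proof -
  have r1: "r \<le> 1" using r rho by simp
  have "r ^ 4 \<le> r" using r r1 power_decreasing[of 1 4 r] by simp
  then have t: "r ^ 4 \<in> {0..e}" using r rho by simp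
  have xe: "x \<in> {0..e}" using x rho by simp
  have B0: "0 \<le> B" using jet t xe unfolding x_jet_def by (meson norm_ge_zero order_trans)
  have C0: "0 \<le> C"
  proof -
    have "0 \<le> C * r ^ (n + 2)" by (rule order_trans[OF norm_ge_zero C[OF x]])
    then show ?thesis using zero_less_power[OF r(1), of "n + 2"] by (metis zero_le_mult_iff not_le)
  qed
  \<comment> \<open>The factor \<open>\<rho>\<close> lets the window fit into
    \<open>{0..\<rho>}\<close>, as r <= 1, and gives L <= r, as \<rho> <= 1. Then C r^(n+2) / L^2 is
    a multiple of r^n, and the top-derivative term is at most B r^n: the two sides balance.\<close>
  define L where "L = \<rho> * r"
  have L: "0 < L" "L \<le> \<rho> - 0" using rho r r1 mult_left_mono[of r 1 \<rho>] by (auto simp: L_def)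
  obtain p where p: "x \<in> {p..p + L}" "{p..p + L} \<subseteq> {0..\<rho>}"
    using subinterval_containing[OF x L] .
  have deriv: "((\<lambda>y. G j y (r ^ 4)) has_vector_derivative G (Suc j) y (r ^ 4)) (at y within {p..p + L})"
    if "j < n + 3" "y \<in> {p..p + L}" for j y
  proof (rule has_vector_derivative_within_subset)
    show sub: "{p..p + L} \<subseteq> {0..e}" using p(2) rho by force
    show "((\<lambda>y. G j y (r ^ 4)) has_vector_derivative G (Suc j) y (r ^ 4)) (at y within {0..e})"
      using jet t that sub unfolding x_jet_def by blast
  qed
  have Gk: "norm (G (n + 3) y (r ^ 4)) \<le> B" if "y \<in> {p..p + L}" for y
  proof -
    have "y \<in> {0..e}" using that p(2) rho by force
    then show ?thesis using jet t unfolding x_jet_def by blast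
  qed
  have G0: "norm (G 0 y (r ^ 4)) \<le> C * r ^ (n + 2)" if "y \<in> {p..p + L}" for y
    using C that p(2) by blast
  have pL: "p < p + L" using L by simp
  have Lr: "L ^ (n + i) \<le> r ^ n" for i
  proof -
    have "L \<le> r" using rho r mult_right_mono[of \<rho> 1 r] by (simp add: L_def)
    then have "L ^ (n + i) \<le> r ^ (n + i)" using L by (intro power_mono) auto
    also have "\<dots> \<le> r ^ n" using r r1 by (intro power_decreasing) auto
    finally show ?thesis .
  qed
  have "norm (G 1 x (r ^ 4)) \<le> 16 * 8 ^ n * (C * r ^ (n + 2) / L + B * L ^ (n + 2))"
    using landau_kolmogorov_first[of p "p + L" "Suc n" "\<lambda>j y. G j y (r ^ 4)", OF pL _ G0 _ p(1), of B]
      deriv Gk by (simp add: numeral_3_eq_3)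
  also have "\<dots> \<le> 16 * 8 ^ n * (C / \<rho> * r ^ n + B * r ^ n)"
  proof (intro mult_left_mono[OF add_mono])
    have "C * r ^ (n + 2) / L = C / \<rho> * r ^ (n + 1)" using r rho by (simp add: L_def)
    also have "\<dots> \<le> C / \<rho> * r ^ n"
      using C0 rho r r1 by (intro mult_left_mono power_decreasing) auto
    finally show "C * r ^ (n + 2) / L \<le> C / \<rho> * r ^ n" .
  qed (use Lr[of 2] B0 in \<open>auto intro: mult_left_mono\<close>)
  finally show "norm (G 1 x (r ^ 4)) \<le> 16 * 8 ^ n * (C / \<rho> + B) * r ^ n"
    by (simp only: distrib_right mult.assoc)
  have "norm (G 2 x (r ^ 4)) \<le> 64 * 64 ^ n * (C * r ^ (n + 2) / (p + L - p)\<^sup>2 + B * (p + L - p) ^ (n + 1))"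
    by (rule landau_kolmogorov_second[of p "p + L" n "\<lambda>j y. G j y (r ^ 4)", OF pL deriv G0 Gk p(1)])
  also have "p + L - p = L" by simp
  also have "C * r ^ (n + 2) / L\<^sup>2 = C / \<rho>\<^sup>2 * r ^ n"
    using r rho by (simp add: L_def power2_eq_square)
  also have "64 * 64 ^ n * (C / \<rho>\<^sup>2 * r ^ n + B * L ^ (n + 1)) \<le> 64 * 64 ^ n * (C / \<rho>\<^sup>2 * r ^ n + B * r ^ n)"
    using Lr[of 1] B0 by (intro mult_left_mono add_left_mono) auto
  finally show "norm (G 2 x (r ^ 4)) \<le> 64 * 64 ^ n * (C / \<rho>\<^sup>2 + B) * r ^ n"
    by (simp only: distrib_right mult.assoc)
qed

section \<open>Raising the order of vanishing in time\<close>

text \<open>The bound on \<open>u'\<close> is asked only for 0 < s < t, because the iteration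
  supplies it at times s = q^4 with q > 0.\<close>

lemma time_growth_bound:
  fixes u :: "real \<Rightarrow> 'a::real_normed_vector"
  assumes t: "t \<in> {0..e}"
    and u: "\<And>s. s \<in> {0..e} \<Longrightarrow> (u has_vector_derivative u' s) (at s within {0..e})"
    and bound: "\<And>s. 0 < s \<Longrightarrow> s < t \<Longrightarrow> norm (u' s) \<le> D"
    and init: "u 0 = 0"
  shows "norm (u t) \<le> D * t"
proof (cases "t = 0")
  case False
  then have t0: "0 < t" using t by simp
  have "norm (u t - u 0) \<le> D * t - D * 0"
  proof (rule differentiable_bound_general[OF t0])
    have "continuous_on {0..e} u"
      unfolding continuous_on_eq_continuous_within
      by (intro ballI has_vector_derivative_continuous[OF u])
    then show "continuous_on {0..t} u" by (rule continuous_on_subset) (use t in auto)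
    show "(u has_vector_derivative u' s) (at s)" if "0 < s" "s < t" for s
      using u[of s] that t by (simp add: at_within_Icc_at)
    show "((*) D has_vector_derivative D) (at s)" for s
      by (auto intro!: derivative_eq_intros)
  qed (auto intro!: continuous_intros bound)
  then show ?thesis using init by simp
qed (simp add: init)

text \<open>Substituting \<open>t = r\<^sup>4\<close> and interpolating on intervals of length proportional to \<open>r\<close>, the bound
  \<open>u = O(r\<^sup>n\<^sup>+\<^sup>2)\<close> costs a factor \<open>r\<^sup>2\<close> in passing to \<open>u\<^sub>x\<^sub>x\<close>, whereas integration in time gains \<open>r\<^sup>4\<close>.\<close>

lemma vanishing_order:
  fixes u u1 u2 ut :: "real \<Rightarrow> real \<Rightarrow> 'a::real_normed_vector"
  assumes e: "0 < e"
    and ut: "\<And>x t. x \<in> {0..e} \<Longrightarrow> t \<in> {0..e} \<Longrightarrow>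
              ((\<lambda>s. u x s) has_vector_derivative ut x t) (at t within {0..e})"
    and K: "0 \<le> K" "\<And>x t. x \<in> {0..e} \<Longrightarrow> t \<in> {0..e} \<Longrightarrow>
              norm (ut x t) \<le> K * (norm (u2 x t) + norm (u x t))"
    and B: "\<And>x t. x \<in> {0..e} \<Longrightarrow> t \<in> {0..e} \<Longrightarrow> norm (ut x t) \<le> B"
    and init: "\<And>x. x \<in> {0..e} \<Longrightarrow> u x 0 = 0"
    and jets: "\<And>k. \<exists>e'>0. \<exists>B' G. x_jet k e' B' G \<and> (\<forall>x\<in>{0..e'}. \<forall>t\<in>{0..e'}.
              G 0 x t = u x t \<and> G 1 x t = u1 x t \<and> G 2 x t = u2 x t)"
  shows "\<exists>\<rho>>0. \<rho> \<le> 1 \<and> (\<exists>C. \<forall>r. 0 < r \<longrightarrow> r \<le> \<rho> \<longrightarrow> (\<forall>x\<in>{0..\<rho>}.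
           norm (u x (r ^ 4)) \<le> C * r ^ n \<and> norm (u1 x (r ^ 4)) \<le> C * r ^ n))"
proof -
  have small: "r ^ 4 \<le> r" if "0 < r" "r \<le> 1" for r :: real
    using that power_decreasing[of 1 4 r] by simp
  \<comment> \<open>The jet of order m + 3 lives on its own square, so each use shrinks the radius.
    A given order takes only finitely many uses, and the radius stays positive.\<close>
  have bounds: "\<exists>\<rho>>0. \<rho> \<le> \<rho>' \<and> (\<exists>C'. \<forall>r. 0 < r \<longrightarrow> r \<le> \<rho> \<longrightarrow> (\<forall>x\<in>{0..\<rho>}.
      norm (u1 x (r ^ 4)) \<le> C' * r ^ m \<and> norm (u2 x (r ^ 4)) \<le> C' * r ^ m))"
    if rho': "0 < \<rho>'" "\<rho>' \<le> 1"
      and C: "\<And>r x. 0 < r \<Longrightarrow> r \<le> \<rho>' \<Longrightarrow> x \<in> {0..\<rho>'} \<Longrightarrow> norm (u x (r ^ 4)) \<le> C * r ^ (m + 2)"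
    for \<rho>' C m
  proof -
    from jets[of "m + 3"] obtain e' B' G where e': "0 < e'" and jet: "x_jet (m + 3) e' B' G"
      and G: "\<And>x t. x \<in> {0..e'} \<Longrightarrow> t \<in> {0..e'} \<Longrightarrow>
        G 0 x t = u x t \<and> G 1 x t = u1 x t \<and> G 2 x t = u2 x t"
      by blast
    define \<rho> where "\<rho> = min \<rho>' e'"
    have rho: "0 < \<rho>" "\<rho> \<le> e'" "\<rho> \<le> 1" "\<rho> \<le> \<rho>'" using rho' e' by (auto simp: \<rho>_def)
    define C1 where "C1 = 16 * 8 ^ m * (C / \<rho> + B')"
    define C2 where "C2 = 64 * 64 ^ m * (C / \<rho>\<^sup>2 + B')"
    have "norm (u1 x (r ^ 4)) \<le> max C1 C2 * r ^ m \<and> norm (u2 x (r ^ 4)) \<le> max C1 C2 * r ^ m"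
      if r: "0 < r" "r \<le> \<rho>" and x: "x \<in> {0..\<rho>}" for r x
    proof -
      have "r ^ 4 \<le> r" using small r rho by simp
      then have t: "r ^ 4 \<in> {0..e'}" using r rho by simp
      have xe: "y \<in> {0..e'} \<and> y \<in> {0..\<rho>'}" if "y \<in> {0..\<rho>}" for y using that rho by simp
      have G0: "norm (G 0 y (r ^ 4)) \<le> C * r ^ (m + 2)" if "y \<in> {0..\<rho>}" for y
        using C[OF r(1) order_trans[OF r(2) rho(4)]] xe[OF that] G[OF _ t] by simp
      note bds = x_jet_bounds[OF jet rho(1,2,3) r x G0]
      have "norm (u1 x (r ^ 4)) \<le> C1 * r ^ m" "norm (u2 x (r ^ 4)) \<le> C2 * r ^ m"
        using bds G[OF _ t] xe[OF x] by (simp_all add: C1_def C2_def)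
      moreover have "C1 * r ^ m \<le> max C1 C2 * r ^ m" "C2 * r ^ m \<le> max C1 C2 * r ^ m"
        using r by (auto intro!: mult_right_mono)
      ultimately show ?thesis by (metis order_trans)
    qed
    then show ?thesis using rho by blast
  qed
  \<comment> \<open>Each round gains two powers of r. The start is the bound on \<open>ut\<close>
    integrated from 0, which gives r^4 and hence r^2.\<close>
  have main: "\<exists>\<rho>>0. \<rho> \<le> 1 \<and> \<rho> \<le> e \<and> (\<exists>C. \<forall>r. 0 < r \<longrightarrow> r \<le> \<rho> \<longrightarrow> (\<forall>x\<in>{0..\<rho>}.
      norm (u x (r ^ 4)) \<le> C * r ^ (2 * m + 2)))" for m
  proof (induction m)
    case 0
    have "norm (u x (r ^ 4)) \<le> B * r ^ (2 * 0 + 2)"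
      if r: "0 < r" "r \<le> min 1 e" and x: "x \<in> {0..min 1 e}" for r x
    proof -
      have t: "r ^ 4 \<in> {0..e}" using small[of r] r by simp
      have x: "x \<in> {0..e}" using x by simp
      have B0: "0 \<le> B" using order_trans[OF norm_ge_zero B[OF x t]] .
      have "norm (u x (r ^ 4)) \<le> B * r ^ 4"
        by (rule time_growth_bound[OF t ut[OF x]]) (use t B[OF x] init[OF x] in auto)
      also have "\<dots> \<le> B * r ^ (2 * 0 + 2)"
        using B0 r by (intro mult_left_mono power_decreasing) auto
      finally show ?thesis .
    qed
    then show ?case using e by (intro exI[of _ "min 1 e"] conjI exI[of _ B]) auto
  next
    case (Suc m)
    then obtain \<rho>' C where rho': "0 < \<rho>'" "\<rho>' \<le> 1" "\<rho>' \<le> e"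
      and C: "\<And>r x. 0 < r \<Longrightarrow> r \<le> \<rho>' \<Longrightarrow> x \<in> {0..\<rho>'} \<Longrightarrow> norm (u x (r ^ 4)) \<le> C * r ^ (2 * m + 2)"
      by blast
    from bounds[OF rho'(1,2) C] obtain \<rho> C' where rho: "0 < \<rho>" "\<rho> \<le> \<rho>'"
      and C': "\<And>r x. 0 < r \<Longrightarrow> r \<le> \<rho> \<Longrightarrow> x \<in> {0..\<rho>} \<Longrightarrow> norm (u2 x (r ^ 4)) \<le> C' * r ^ (2 * m)"
      by blast
    have "norm (u x (r ^ 4)) \<le> (K * (\<bar>C'\<bar> + \<bar>C\<bar>)) * r ^ (2 * Suc m + 2)"
      if r: "0 < r" "r \<le> \<rho>" and x: "x \<in> {0..\<rho>}" for r x
    proof -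
      have r1: "r \<le> 1" using r rho rho' by simp
      have t: "r ^ 4 \<in> {0..e}" using small[of r] r rho rho' by simp
      have xe: "x \<in> {0..e}" "x \<in> {0..\<rho>'}" using x rho rho' by auto
      have "norm (u x (r ^ 4)) \<le> (K * (\<bar>C'\<bar> + \<bar>C\<bar>) * r ^ (2 * m)) * r ^ 4"
      proof (rule time_growth_bound[OF t ut[OF xe(1)] _ init[OF xe(1)]])
        fix s assume s: "0 < s" "s < r ^ 4"
        \<comment> \<open>Every intermediate time is itself a fourth power q^4 with q < r, so the
          induction hypothesis applies at it and its bounds increase to those at r.\<close>
        define q where "q = root 4 s"
        have q: "0 < q" "q ^ 4 = s" using s by (auto simp: q_def)
        have qr: "q < r" using s q r by (metis power_less_imp_less_base less_imp_le)
        have se: "s \<in> {0..e}" using s t by simp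
        have pw: "q ^ (2 * m) \<le> r ^ (2 * m)" using q qr by (intro power_mono) auto
        have "norm (u2 x s) \<le> C' * q ^ (2 * m)" using C'[of q x] q qr r x by simp
        also have "\<dots> \<le> \<bar>C'\<bar> * r ^ (2 * m)" using pw q by (intro mult_mono) auto
        finally have 1: "norm (u2 x s) \<le> \<bar>C'\<bar> * r ^ (2 * m)" .
        have "norm (u x s) \<le> C * q ^ (2 * m + 2)" using C[of q x] q qr r rho xe by simp
        also have "\<dots> \<le> \<bar>C\<bar> * q ^ (2 * m)"
          using q qr r1 by (intro mult_mono power_decreasing) auto
        also have "\<dots> \<le> \<bar>C\<bar> * r ^ (2 * m)" using pw by (intro mult_left_mono) auto
        finally have 2: "norm (u x s) \<le> \<bar>C\<bar> * r ^ (2 * m)" .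
        have "norm (ut x s) \<le> K * (norm (u2 x s) + norm (u x s))" using K(2)[OF xe(1) se] .
        also have "\<dots> \<le> K * (\<bar>C'\<bar> * r ^ (2 * m) + \<bar>C\<bar> * r ^ (2 * m))"
          using 1 2 K(1) by (intro mult_left_mono add_mono) auto
        finally show "norm (ut x s) \<le> K * (\<bar>C'\<bar> + \<bar>C\<bar>) * r ^ (2 * m)"
          by (simp only: distrib_right mult.assoc)
      qed auto
      also have "\<dots> = (K * (\<bar>C'\<bar> + \<bar>C\<bar>)) * r ^ (2 * Suc m + 2)"
        by (simp add: power_add[symmetric] mult.assoc numeral_eq_Suc)
      finally show ?thesis .
    qed
    then show ?case using rho rho' by (intro exI[of _ \<rho>] conjI exI[of _ "K * (\<bar>C'\<bar> + \<bar>C\<bar>)"]) auto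
  qed
  \<comment> \<open>Order 2n + 2 for \<open>u\<close> leaves order 2n for \<open>u1\<close> after
    one more interpolation; both are then lowered to n.\<close>
  from main[of n] obtain \<rho>' C where rho': "0 < \<rho>'" "\<rho>' \<le> 1"
    and C: "\<And>r x. 0 < r \<Longrightarrow> r \<le> \<rho>' \<Longrightarrow> x \<in> {0..\<rho>'} \<Longrightarrow> norm (u x (r ^ 4)) \<le> C * r ^ (2 * n + 2)"
    by blast
  from bounds[OF rho' C] obtain \<rho> C' where rho: "0 < \<rho>" "\<rho> \<le> \<rho>'"
    and C': "\<And>r x. 0 < r \<Longrightarrow> r \<le> \<rho> \<Longrightarrow> x \<in> {0..\<rho>} \<Longrightarrow> norm (u1 x (r ^ 4)) \<le> C' * r ^ (2 * n)"
    by blast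
  have "norm (u x (r ^ 4)) \<le> max \<bar>C\<bar> \<bar>C'\<bar> * r ^ n \<and> norm (u1 x (r ^ 4)) \<le> max \<bar>C\<bar> \<bar>C'\<bar> * r ^ n"
    if r: "0 < r" "r \<le> \<rho>" and x: "x \<in> {0..\<rho>}" for r x
  proof
    have r1: "r \<le> 1" using r rho rho' by simp
    have "norm (u x (r ^ 4)) \<le> C * r ^ (2 * n + 2)" using C r rho x by simp
    also have "\<dots> \<le> max \<bar>C\<bar> \<bar>C'\<bar> * r ^ n"
      using r r1 by (intro mult_mono power_decreasing) auto
    finally show "norm (u x (r ^ 4)) \<le> max \<bar>C\<bar> \<bar>C'\<bar> * r ^ n" .
    have "norm (u1 x (r ^ 4)) \<le> C' * r ^ (2 * n)" using C' r x by simp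
    also have "\<dots> \<le> max \<bar>C\<bar> \<bar>C'\<bar> * r ^ n"
      using r r1 by (intro mult_mono power_decreasing) auto
    finally show "norm (u1 x (r ^ 4)) \<le> max \<bar>C\<bar> \<bar>C'\<bar> * r ^ n" .
  qed
  then show ?thesis using rho rho' by (intro exI[of _ \<rho>] conjI exI[of _ "max \<bar>C\<bar> \<bar>C'\<bar>"]) auto
qed

text \<open>Undoes t = r^4: order n in t is order 4n in r. The estimates with r > 0 say nothing
  about t = 0, so that value is assumed separately.\<close>

lemma flat_at_0_fourth_power:
  assumes f0: "f 0 = 0"
    and f: "\<And>n. \<exists>\<rho>>0. \<exists>C. \<forall>r. 0 < r \<longrightarrow> r \<le> \<rho> \<longrightarrow> norm (f (r ^ 4)) \<le> C * r ^ n"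
  shows "flat_at_0 f"
  unfolding flat_at_0_def
proof
  fix n
  from f[of "4 * n"] obtain \<rho> C where rho: "0 < \<rho>"
    and C: "\<And>r. 0 < r \<Longrightarrow> r \<le> \<rho> \<Longrightarrow> norm (f (r ^ 4)) \<le> C * r ^ (4 * n)" by blast
  have "norm (f t) \<le> \<bar>C\<bar> * t ^ n" if t: "t \<in> {0..\<rho> ^ 4}" for t
  proof (cases "t = 0")
    case False
    define r where "r = root 4 t"
    have r: "0 < r" "r ^ 4 = t" using t False by (auto simp: r_def)
    have "r \<le> \<rho>" using t r rho by (metis atLeastAtMost_iff less_imp_le power_mono_iff zero_less_numeral)
    then have "norm (f t) \<le> C * t ^ n" using C[of r] r by (simp add: power_mult)
    also have "\<dots> \<le> \<bar>C\<bar> * t ^ n" using t by (intro mult_right_mono) auto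
    finally show ?thesis .
  qed (simp add: f0)
  then show "\<exists>e>0. \<exists>C. \<forall>t\<in>{0..e}. norm (f t) \<le> C * t ^ n"
    using zero_less_power[OF rho, of 4] by blast
qed

section \<open>Norm estimates for the cubic term\<close>

lemma norm_cscale: "norm (cscale c A) = cmod c * norm A"
  by (simp add: cscale_def norm_vec_def norm_mult L2_set_right_distrib[symmetric])

lemma cscale_diff: "cscale c (A - B) = cscale c A - cscale c B"
  by (simp add: cscale_def vec_eq_iff right_diff_distrib)

lemma bounded_bilinear_matrix_mult:
  "bounded_bilinear ((**) :: complex ^ 'n ^ 'm \<Rightarrow> complex ^ 'p ^ 'n \<Rightarrow> complex ^ 'p ^ 'm)"
  unfolding bilinear_conv_bounded_bilinear[symmetric] bilinear_def
  by (auto intro!: linearI simp: matrix_matrix_mult_def vec_eq_iff scaleR_sum_right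
      distrib_left distrib_right sum.distrib)

text \<open>Conjugation is not complex-linear, but linearity here is over the reals, and finite
  dimension gives boundedness.\<close>

lemma bounded_linear_conj_transpose:
  "bounded_linear (conj_transpose :: complex ^ 'n ^ 'm \<Rightarrow> complex ^ 'm ^ 'n)"
  unfolding linear_conv_bounded_linear[symmetric]
  by (auto intro!: linearI simp: conj_transpose_def vec_eq_iff)

lemma cubic_locally_lipschitz:
  obtains K where "0 \<le> K"
    "\<And>V W :: complex ^ 'n ^ 'm. norm V \<le> R \<Longrightarrow> norm W \<le> R \<Longrightarrow>
       norm (V ** conj_transpose V ** V - W ** conj_transpose W ** W) \<le> K * norm (V - W)"
proof -
  let ?P = "(**) :: complex ^ 'n ^ 'm \<Rightarrow> complex ^ 'm ^ 'n \<Rightarrow> complex ^ 'm ^ 'm"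
  let ?Q = "(**) :: complex ^ 'm ^ 'm \<Rightarrow> complex ^ 'n ^ 'm \<Rightarrow> complex ^ 'n ^ 'm"
  let ?T = "conj_transpose :: complex ^ 'n ^ 'm \<Rightarrow> complex ^ 'm ^ 'n"
  obtain p where p: "0 \<le> p" "\<And>A B. norm (?P A B) \<le> norm A * norm B * p"
    using bounded_bilinear.nonneg_bounded[OF bounded_bilinear_matrix_mult] by blast
  obtain q where q: "0 \<le> q" "\<And>A B. norm (?Q A B) \<le> norm A * norm B * q"
    using bounded_bilinear.nonneg_bounded[OF bounded_bilinear_matrix_mult] by blast
  obtain c where c: "0 \<le> c" "\<And>A. norm (?T A) \<le> norm A * c"
    using bounded_linear.nonneg_bounded[OF bounded_linear_conj_transpose] by blast
  have triple: "norm (?Q (?P A (?T B)) C) \<le> c * p * q * (norm A * norm B * norm C)" for A B C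
  proof -
    have "norm (?Q (?P A (?T B)) C) \<le> norm (?P A (?T B)) * norm C * q" by (rule q(2))
    also have "\<dots> \<le> (norm A * norm (?T B) * p) * norm C * q"
      using p(2) q(1) by (intro mult_right_mono) auto
    also have "\<dots> \<le> (norm A * (norm B * c) * p) * norm C * q"
      using c(2) p(1) q(1) by (intro mult_right_mono mult_left_mono) auto
    finally show ?thesis by (simp only: mult_ac)
  qed
  have "norm (V ** ?T V ** V - W ** ?T W ** W) \<le> 3 * (c * p * q * R\<^sup>2) * norm (V - W)"
    if V: "norm V \<le> R" and W: "norm W \<le> R" for V W
  proof -
    have R: "0 \<le> R" using V norm_ge_zero order_trans by blast
    \<comment> \<open>Telescoping: one factor is exchanged at a time, so each of the three summands
      contains V - W once and two factors of norm at most \<open>R\<close>.\<close>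
    have "V ** ?T V ** V - W ** ?T W ** W =
      (V - W) ** ?T V ** V + W ** ?T (V - W) ** V + W ** ?T W ** (V - W)"
      by (simp add: bounded_bilinear.diff_left[OF bounded_bilinear_matrix_mult]
          bounded_bilinear.diff_right[OF bounded_bilinear_matrix_mult]
          linear_diff[OF bounded_linear.linear[OF bounded_linear_conj_transpose]])
    then have "norm (V ** ?T V ** V - W ** ?T W ** W) \<le>
      norm ((V - W) ** ?T V ** V) + norm (W ** ?T (V - W) ** V) + norm (W ** ?T W ** (V - W))"
      using norm_triangle_le[OF add_right_mono[OF norm_triangle_ineq]] by (metis order_refl)
    also have "\<dots> \<le> c * p * q * (norm (V - W) * norm V * norm V) +
        c * p * q * (norm W * norm (V - W) * norm V) + c * p * q * (norm W * norm W * norm (V - W))"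
      by (intro add_mono triple)
    also have "\<dots> \<le> c * p * q * (norm (V - W) * R * R) +
        c * p * q * (R * norm (V - W) * R) + c * p * q * (R * R * norm (V - W))"
      using V W c(1) p(1) q(1) R by (intro add_mono mult_left_mono mult_mono) auto
    finally show ?thesis by (simp add: power2_eq_square mult_ac)
  qed
  moreover have "0 \<le> 3 * (c * p * q * R\<^sup>2)" using c p q by simp
  ultimately show ?thesis using that by blast
qed

section \<open>The difference of two solutions\<close>

lemma C_eps_locally_bounded:
  assumes v: "v \<in> C_eps a" and e: "e < a"
  obtains B where "\<forall>x\<in>{0..e}. \<forall>t\<in>{0..e}. norm (v x t) \<le> B \<and> norm (deriv_t a v x t) \<le> B"
proof -
  have sub: "corner_square e \<subseteq> nls_domain a" using e by (auto simp: corner_square_def nls_domain_def)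
  have "continuous_on (corner_square e) (\<lambda>(x, t). v x t)"
    "continuous_on (corner_square e) (\<lambda>(x, t). deriv_t a v x t)"
    using v sub unfolding C_eps_def continuously_differentiable_def
    by (auto intro: differentiable_imp_continuous_on continuous_on_subset)
  note cont = this
  obtain B1 where B1: "\<forall>x\<in>{0..e}. \<forall>t\<in>{0..e}. norm (v x t) \<le> B1"
    using continuous_on_corner_square_bounded[OF cont(1)] by auto
  obtain B2 where B2: "\<forall>x\<in>{0..e}. \<forall>t\<in>{0..e}. norm (deriv_t a v x t) \<le> B2"
    using continuous_on_corner_square_bounded[OF cont(2)] by auto
  from B1 B2 have "\<forall>x\<in>{0..e}. \<forall>t\<in>{0..e}.
      norm (v x t) \<le> max B1 B2 \<and> norm (deriv_t a v x t) \<le> max B1 B2"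
    by (simp add: le_max_iff_disj)
  then show ?thesis by (rule that)
qed

text \<open>Supplies u_x(0,0) = 0 from initial data that agree only for x >= 0; this is the value at
  t = 0 that the estimates in r > 0 miss.\<close>

lemma deriv_x_cong:
  assumes "\<And>y. 0 \<le> y \<Longrightarrow> v y t = w y t" and "0 \<le> x"
  shows "deriv_x v x t = deriv_x w x t"
proof -
  have "((\<lambda>y. v y t) has_vector_derivative d) (at x within {0..}) \<longleftrightarrow>
        ((\<lambda>y. w y t) has_vector_derivative d) (at x within {0..})" for d
    using assms by (auto elim!: has_vector_derivative_transform[rotated 2])
  then show ?thesis by (simp add: deriv_x_def vector_derivative_def)
qed

lemma boundary_difference_flat:
  fixes v w :: "real \<Rightarrow> real \<Rightarrow> complex ^ 'm2 ^ 'm1"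
  assumes a: "0 < a" and v: "v \<in> C_eps a" and w: "w \<in> C_eps a"
    and nlsv: "solves_defocusing_nls a v" and nlsw: "solves_defocusing_nls a w"
    and init: "\<forall>x\<ge>0. v x 0 = w x 0"
  shows "flat_at_0 (\<lambda>t. v 0 t - w 0 t)"
    and "flat_at_0 (\<lambda>t. deriv_x v 0 t - deriv_x w 0 t)"
proof -
  \<comment> \<open>Staying away from t = a makes the square compact inside the domain, so both
    solutions and their t-derivatives are bounded on it.\<close>
  define e where "e = a / 2"
  have e: "0 < e" "e < a" using a by (auto simp: e_def)
  obtain Bv where Bv: "\<forall>x\<in>{0..e}. \<forall>t\<in>{0..e}. norm (v x t) \<le> Bv \<and> norm (deriv_t a v x t) \<le> Bv"
    using C_eps_locally_bounded[OF v e(2)] .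
  obtain Bw where Bw: "\<forall>x\<in>{0..e}. \<forall>t\<in>{0..e}. norm (w x t) \<le> Bw \<and> norm (deriv_t a w x t) \<le> Bw"
    using C_eps_locally_bounded[OF w e(2)] .
  let ?Q = "\<lambda>V :: complex ^ 'm2 ^ 'm1. V ** conj_transpose V ** V"
  obtain K where K: "0 \<le> K"
    "\<And>V W :: complex ^ 'm2 ^ 'm1. norm V \<le> max Bv Bw \<Longrightarrow> norm W \<le> max Bv Bw \<Longrightarrow>
       norm (?Q V - ?Q W) \<le> K * norm (V - W)"
    using cubic_locally_lipschitz[where R = "max Bv Bw"] by blast
  define u where "u x t = v x t - w x t" for x t
  define u1 where "u1 x t = deriv_x v x t - deriv_x w x t" for x t
  define u2 where "u2 x t = deriv_x (deriv_x v) x t - deriv_x (deriv_x w) x t" for x t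
  define ut where "ut x t = deriv_t a v x t - deriv_t a w x t" for x t
  have order: "\<exists>\<rho>>0. \<rho> \<le> 1 \<and> (\<exists>C. \<forall>r. 0 < r \<longrightarrow> r \<le> \<rho> \<longrightarrow> (\<forall>x\<in>{0..\<rho>}.
      norm (u x (r ^ 4)) \<le> C * r ^ n \<and> norm (u1 x (r ^ 4)) \<le> C * r ^ n))" for n
  proof (rule vanishing_order[OF e(1)])
    fix x t assume x: "x \<in> {0..e}" and t: "t \<in> {0..e}"
    have dom: "0 \<le> x" "0 \<le> t" "t < a" using x t e by auto
    have sub: "{0..e} \<subseteq> {0..<a}" using e by auto
    show "((\<lambda>s. u x s) has_vector_derivative ut x t) (at t within {0..e})"
      unfolding u_def ut_def
      using C_eps_has_derivs(3)[OF v dom] C_eps_has_derivs(3)[OF w dom] sub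
      by (intro has_vector_derivative_diff) (auto elim!: has_vector_derivative_within_subset)
    show "norm (ut x t) \<le> Bv + Bw"
      unfolding ut_def using Bv Bw x t norm_triangle_ineq4 by (meson add_mono order_trans)
    have "cscale 2 (deriv_t a v x t) = cscale \<i> (deriv_x (deriv_x v) x t - cscale 2 (?Q (v x t)))"
      "cscale 2 (deriv_t a w x t) = cscale \<i> (deriv_x (deriv_x w) x t - cscale 2 (?Q (w x t)))"
      using nlsv nlsw dom by (auto simp: solves_defocusing_nls_def nls_domain_def)
    then have "cscale 2 (ut x t) = cscale \<i> (u2 x t - cscale 2 (?Q (v x t) - ?Q (w x t)))"
      unfolding ut_def u2_def by (simp add: cscale_diff)
    from arg_cong[OF this, of norm]
    have "2 * norm (ut x t) = norm (u2 x t - cscale 2 (?Q (v x t) - ?Q (w x t)))"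
      by (simp add: norm_cscale)
    also have "\<dots> \<le> norm (u2 x t) + 2 * norm (?Q (v x t) - ?Q (w x t))"
      using norm_triangle_ineq4[of "u2 x t" "cscale 2 (?Q (v x t) - ?Q (w x t))"]
      by (simp add: norm_cscale)
    also have "norm (?Q (v x t) - ?Q (w x t)) \<le> K * norm (u x t)"
      unfolding u_def using Bv Bw x t by (intro K(2)) (auto simp: le_max_iff_disj)
    finally have "norm (ut x t) \<le> norm (u2 x t) / 2 + K * norm (u x t)" by simp
    \<comment> \<open>The factor 1 + K dominates both coefficients, 1/2 and K.\<close>
    also have "\<dots> \<le> (1 + K) * (norm (u2 x t) + norm (u x t))"
      using K(1) by (simp add: distrib_left distrib_right)
    finally show "norm (ut x t) \<le> (1 + K) * (norm (u2 x t) + norm (u x t))" .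
  next
    fix k
    obtain e1 B1 G1 where 1: "0 < e1" "x_jet k e1 B1 G1"
      "\<And>x t. x \<in> {0..e1} \<Longrightarrow> t \<in> {0..e1} \<Longrightarrow>
         G1 0 x t = v x t \<and> G1 1 x t = deriv_x v x t \<and> G1 2 x t = deriv_x (deriv_x v) x t"
      using C_eps_x_jet[OF v] by metis
    obtain e2 B2 G2 where 2: "0 < e2" "x_jet k e2 B2 G2"
      "\<And>x t. x \<in> {0..e2} \<Longrightarrow> t \<in> {0..e2} \<Longrightarrow>
         G2 0 x t = w x t \<and> G2 1 x t = deriv_x w x t \<and> G2 2 x t = deriv_x (deriv_x w) x t"
      using C_eps_x_jet[OF w] by metis
    show "\<exists>e'>0. \<exists>B' G. x_jet k e' B' G \<and> (\<forall>x\<in>{0..e'}. \<forall>t\<in>{0..e'}.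
            G 0 x t = u x t \<and> G 1 x t = u1 x t \<and> G 2 x t = u2 x t)"
      using x_jet_diff[OF 1(2) 2(2)] 1(1,3) 2(1,3)
      by (intro exI[of _ "min e1 e2"] conjI exI[of _ "B1 + B2"] exI[of _ "\<lambda>j x t. G1 j x t - G2 j x t"])
        (auto simp: u_def u1_def u2_def)
  qed (use K(1) init in \<open>auto simp: u_def\<close>)
  have z: "u 0 0 = 0" "u1 0 0 = 0"
    using init deriv_x_cong[of v 0 w 0] by (auto simp: u_def u1_def)
  have order0: "\<exists>\<rho>>0. \<exists>C. \<forall>r. 0 < r \<longrightarrow> r \<le> \<rho> \<longrightarrow>
      norm (u 0 (r ^ 4)) \<le> C * r ^ n \<and> norm (u1 0 (r ^ 4)) \<le> C * r ^ n" for n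
    using order[of n] by (meson atLeastAtMost_iff less_imp_le order_refl)
  have "flat_at_0 (u 0)" by (rule flat_at_0_fourth_power[where f = "u 0", OF z(1)]) (use order0 in meson)
  moreover have "flat_at_0 (u1 0)" by (rule flat_at_0_fourth_power[where f = "u1 0", OF z(2)]) (use order0 in meson)
  ultimately show "flat_at_0 (\<lambda>t. v 0 t - w 0 t)" "flat_at_0 (\<lambda>t. deriv_x v 0 t - deriv_x w 0 t)"
    by (simp_all add: u_def[abs_def] u1_def[abs_def])
qed

theorem corollary3p4:
  fixes a :: real
    and v w :: "real \<Rightarrow> real \<Rightarrow> complex ^ 'm2 ^ 'm1"
    and M N :: "'m1 \<Rightarrow> 'm2 \<Rightarrow> nat \<Rightarrow> real"
  assumes "0 < a"
    and "v \<in> C_eps a" and "w \<in> C_eps a"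
    and "solves_defocusing_nls a v" and "solves_defocusing_nls a w"
    and "\<forall>x\<ge>0. v x 0 = w x 0"
  shows "((\<forall>i j. quasi_analytic a (M i j)) \<and>
           entries_in_classes a M (\<lambda>t. v 0 t) \<and> entries_in_classes a M (\<lambda>t. w 0 t)
           \<longrightarrow> (\<forall>t\<in>{0..<a}. v 0 t = w 0 t)) \<and>
         ((\<forall>i j. quasi_analytic a (N i j)) \<and>
           entries_in_classes a N (\<lambda>t. deriv_x v 0 t) \<and> entries_in_classes a N (\<lambda>t. deriv_x w 0 t)
           \<longrightarrow> (\<forall>t\<in>{0..<a}. deriv_x v 0 t = deriv_x w 0 t))"
proof (intro conjI impI ballI; elim conjE)
  note flat = boundary_difference_flat[OF assms]
  fix t assume t: "t \<in> {0..<a}"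
  show "v 0 t = w 0 t" if "\<forall>i j. quasi_analytic a (M i j)"
    "entries_in_classes a M (\<lambda>t. v 0 t)" "entries_in_classes a M (\<lambda>t. w 0 t)"
    using quasi_analytic_eq[OF \<open>0 < a\<close> that flat(1) t] .
  show "deriv_x v 0 t = deriv_x w 0 t" if "\<forall>i j. quasi_analytic a (N i j)"
    "entries_in_classes a N (\<lambda>t. deriv_x v 0 t)" "entries_in_classes a N (\<lambda>t. deriv_x w 0 t)"
    using quasi_analytic_eq[OF \<open>0 < a\<close> that flat(2) t] .
qed

end
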